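(* Let $(\{1,2\},A_1,A_2,u_1,u_2)$ be a two-player finite strategic game. Then $P(S_{\mathrm{nc}}^{\mathbb{Q}})\subseteq P(S_{\mathrm{nc}})$ and $P(S_{\mathrm{co}}^{\mathbb{Q}})\subseteq P(S_{\mathrm{co}})$.
   Context: A two-player finite strategic game $(\{1,2\},A_1,A_2,u_1,u_2)$ consists of nonempty finite sets $A_1,A_2$ of pure strategies and payoff functions $u_1,u_2\colon A_1\times A_2\to\mathbb{R}$; put $u=(u_1,u_2)\colon A_1\times A_2\to\mathbb{R}^2$. For a nonempty finite set $X$, $\Delta(X)$ is the set of probability distributions on $X$. For a mixed-strategy profile $(\sigma_1,\sigma_2)\in\Delta(A_1)\times\Delta(A_2)$ set $u(\sigma_1,\sigma_2)=\sum_{a_1\in A_1}\sum_{a_2\in A_2}\sigma_1(a_1)\sigma_2(a_2)\,u(a_1,a_2)$; for a correlated strategy $\varphi\in\Delta(A_1\times A_2)$ set $u(\varphi)=\sum_{a\in A_1\times A_2}\varphi(a)u(a)$. $S_{\mathrm{nc}}=u(\Delta(A_1)\times\Delta(A_2))$ is the noncooperative payoff region and $S_{\mathrm{co}}=u(\Delta(A_1\times A_2))$ is the cooperative payoff region. $S_{\mathrm{nc}}^{\mathbb{Q}}$ is the set of all $u(\sigma_1,\sigma_2)$ where $\sigma_1\in\Delta(A_1)$ and $\sigma_2\in\Delta(A_2)$ take only rational values. $S_{\mathrm{co}}^{\mathbb{Q}}$ is the set of all convex combinations with rational coefficients of the pure-payoff profiles $u(a)$, $a\in A_1\times A_2$.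 A point $w\in\mathbb{R}^n$ Pareto dominates $v\in\mathbb{R}^n$ if $w\ne v$ and $w_i\ge v_i$ for all $i=1,\dots,n$. The Pareto frontier $P(S)$ of a nonempty set $S\subseteq\mathbb{R}^n$ is the set of $v\in S$ such that no $w\in S$ Pareto dominates $v$. *)

theory Defs
  imports "HOL-Analysis.Analysis" "HOL-Probability.Probability_Mass_Function"
begin

definition pareto_dominates :: "real ^ 'n \<Rightarrow> real ^ 'n \<Rightarrow> bool" where
  "pareto_dominates w v \<longleftrightarrow> w \<noteq> v \<and> (\<forall>i. v $ i \<le> w $ i)"

definition pareto_frontier :: "(real ^ 'n) set \<Rightarrow> (real ^ 'n) set" where
  "pareto_frontier S = {v \<in> S. \<not> (\<exists>w\<in>S. pareto_dominates w v)}"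

(* Distributions on X are pmfs on the ambient type that put no mass outside X. *)
definition distributions :: "'a set \<Rightarrow> 'a pmf set" where
  "distributions X = {p. set_pmf p \<subseteq> X}"

definition rational_distributions :: "'a set \<Rightarrow> 'a pmf set" where
  "rational_distributions X = {p \<in> distributions X. \<forall>x\<in>X. pmf p x \<in> \<rat>}"

definition payoff :: "('a \<times> 'b \<Rightarrow> real) \<Rightarrow> ('a \<times> 'b \<Rightarrow> real) \<Rightarrow> 'a \<times> 'b \<Rightarrow> real ^ 2" where
  "payoff u\<^sub>1 u\<^sub>2 a = vector [u\<^sub>1 a, u\<^sub>2 a]"

definition mixed_payoff ::
    "'a set \<Rightarrow> 'b set \<Rightarrow> ('a \<times> 'b \<Rightarrow> real ^ 2) \<Rightarrow> 'a pmf \<Rightarrow> 'b pmf \<Rightarrow> real ^ 2" where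
  "mixed_payoff A\<^sub>1 A\<^sub>2 u \<sigma>\<^sub>1 \<sigma>\<^sub>2 =
     (\<Sum>a\<^sub>1\<in>A\<^sub>1. \<Sum>a\<^sub>2\<in>A\<^sub>2. (pmf \<sigma>\<^sub>1 a\<^sub>1 * pmf \<sigma>\<^sub>2 a\<^sub>2) *\<^sub>R u (a\<^sub>1, a\<^sub>2))"

definition correlated_payoff ::
    "'a set \<Rightarrow> 'b set \<Rightarrow> ('a \<times> 'b \<Rightarrow> real ^ 2) \<Rightarrow> ('a \<times> 'b) pmf \<Rightarrow> real ^ 2" where
  "correlated_payoff A\<^sub>1 A\<^sub>2 u \<phi> = (\<Sum>a\<in>A\<^sub>1 \<times> A\<^sub>2. pmf \<phi> a *\<^sub>R u a)"

definition S_nc :: "'a set \<Rightarrow> 'b set \<Rightarrow> ('a \<times> 'b \<Rightarrow> real ^ 2) \<Rightarrow> (real ^ 2) set" where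
  "S_nc A\<^sub>1 A\<^sub>2 u = {mixed_payoff A\<^sub>1 A\<^sub>2 u \<sigma>\<^sub>1 \<sigma>\<^sub>2 | \<sigma>\<^sub>1 \<sigma>\<^sub>2.
     \<sigma>\<^sub>1 \<in> distributions A\<^sub>1 \<and> \<sigma>\<^sub>2 \<in> distributions A\<^sub>2}"

definition S_co :: "'a set \<Rightarrow> 'b set \<Rightarrow> ('a \<times> 'b \<Rightarrow> real ^ 2) \<Rightarrow> (real ^ 2) set" where
  "S_co A\<^sub>1 A\<^sub>2 u = correlated_payoff A\<^sub>1 A\<^sub>2 u ` distributions (A\<^sub>1 \<times> A\<^sub>2)"

definition S_nc_rat :: "'a set \<Rightarrow> 'b set \<Rightarrow> ('a \<times> 'b \<Rightarrow> real ^ 2) \<Rightarrow> (real ^ 2) set" where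
  "S_nc_rat A\<^sub>1 A\<^sub>2 u = {mixed_payoff A\<^sub>1 A\<^sub>2 u \<sigma>\<^sub>1 \<sigma>\<^sub>2 | \<sigma>\<^sub>1 \<sigma>\<^sub>2.
     \<sigma>\<^sub>1 \<in> rational_distributions A\<^sub>1 \<and> \<sigma>\<^sub>2 \<in> rational_distributions A\<^sub>2}"

definition S_co_rat :: "'a set \<Rightarrow> 'b set \<Rightarrow> ('a \<times> 'b \<Rightarrow> real ^ 2) \<Rightarrow> (real ^ 2) set" where
  "S_co_rat A\<^sub>1 A\<^sub>2 u = {(\<Sum>a\<in>A\<^sub>1 \<times> A\<^sub>2. c a *\<^sub>R u a) | c.
     (\<forall>a\<in>A\<^sub>1 \<times> A\<^sub>2. c a \<in> \<rat> \<and> 0 \<le> c a) \<and> (\<Sum>a\<in>A\<^sub>1 \<times> A\<^sub>2. c a) = 1}"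

end

(* For weights c on a finite set and linear functionals G > x, H >= y of c, rational weights with the
   same two inequalities exist.  If some vertex has h > y, moving c slightly towards it makes both
   inequalities strict, and a rational approximation works.  Otherwise h = y on the support of c, and
   some vertex of the support, which is rational, has g > x.  Hence a point dominating v can be
   replaced by a rational one: for correlated strategies at once, and for mixed strategies one player
   at a time, the payoff being affine in each player's strategy. *)
theory Submission
  imports Defs
begin

section \<open>Weights and distributions on a finite set, and their rational replacements\<close>

definition simplex_weights :: "'a set \<Rightarrow> ('a \<Rightarrow> real) set" where
  "simplex_weights A = {c. (\<forall>a\<in>A. 0 \<le> c a) \<and> sum c A = 1}"

lemma pmf_simplex_weights:
  assumes "finite A" and "p \<in> distributions A"
  shows "pmf p \<in> simplex_weights A"
  using assms by (auto simp: simplex_weights_def distributions_def intro: sum_pmf_eq_1)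

text \<open>Lets constructions be carried out on plain functions, where convex combinations and
  limits are pointwise, before returning to type \<open>pmf\<close>.\<close>

lemma simplex_weights_pmf:
  assumes "finite A" and "c \<in> simplex_weights A"
  obtains p where "p \<in> distributions A" and "\<And>a. a \<in> A \<Longrightarrow> pmf p a = c a"
proof
  \<comment> \<open>\<open>c\<close> may be arbitrary off \<open>A\<close>; cutting it to 0 there
    gives total mass 1 on the whole type, as \<open>embed_pmf\<close> requires.\<close>
  define d where "d a = (if a \<in> A then c a else 0)" for a
  have nonneg: "0 \<le> d a" for a
    using assms(2) by (auto simp: d_def simplex_weights_def)
  have "(\<integral>\<^sup>+a. ennreal (d a) \<partial>count_space UNIV) = (\<Sum>a\<in>A. ennreal (d a))"
    by (rule nn_integral_count_space'[OF assms(1)]) (auto simp: d_def)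
  also have "\<dots> = ennreal (sum d A)"
    using nonneg by (simp add: sum_ennreal)
  also have "sum d A = sum c A"
    by (rule sum.cong) (auto simp: d_def)
  finally have one: "(\<integral>\<^sup>+a. ennreal (d a) \<partial>count_space UNIV) = 1"
    using assms(2) by (simp add: simplex_weights_def)
  have d: "pmf (embed_pmf d) a = d a" for a
    by (rule pmf_embed_pmf) (use nonneg one in auto)
  show "embed_pmf d \<in> distributions A"
    by (auto simp: distributions_def set_pmf_eq d d_def)
  show "pmf (embed_pmf d) a = c a" if "a \<in> A" for a
    using that by (simp add: d d_def)
qed

text \<open>Rounding down to multiples of \<open>1 / Suc n\<close> keeps weights rational,
  nonnegative and at most \<open>c\<close>. One point \<open>b\<close> takes all the remaining mass,
  which is then at least \<open>c b\<close>.\<close>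

lemma rational_simplex_weights_tendsto:
  fixes c :: "'a \<Rightarrow> real"
  assumes "finite A" and "c \<in> simplex_weights A"
  obtains q where "\<And>n. q n \<in> simplex_weights A" and "\<And>n a. a \<in> A \<Longrightarrow> q n a \<in> \<rat>"
    and "\<And>a. a \<in> A \<Longrightarrow> (\<lambda>n. q n a) \<longlonglongrightarrow> c a"
proof -
  from assms(2) have c: "\<And>a. a \<in> A \<Longrightarrow> 0 \<le> c a" and c1: "sum c A = 1"
    by (auto simp: simplex_weights_def)
  obtain b where b: "b \<in> A"
    using c1 by fastforce
  define r where "r n a = real_of_int \<lfloor>real (Suc n) * c a\<rfloor> / real (Suc n)" for n a
  define q where "q n a = (if a = b then 1 - sum (r n) (A - {b}) else r n a)" for n a
  have r_le: "r n a \<le> c a" for n a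
    by (simp add: r_def divide_le_eq mult.commute)
  have r_ge: "c a - inverse (real (Suc n)) \<le> r n a" for n a
  proof -
    have "real (Suc n) * c a - 1 \<le> real_of_int \<lfloor>real (Suc n) * c a\<rfloor>"
      by linarith
    then have "(real (Suc n) * c a - 1) / real (Suc n) \<le> r n a"
      unfolding r_def by (rule divide_right_mono) simp
    then show ?thesis
      by (simp add: diff_divide_distrib inverse_eq_divide)
  qed
  have r_lim: "(\<lambda>n. r n a) \<longlonglongrightarrow> c a" for a
  proof (rule tendsto_sandwich)
    show "(\<lambda>n. c a - inverse (real (Suc n))) \<longlonglongrightarrow> c a"
      using tendsto_diff[OF tendsto_const LIMSEQ_inverse_real_of_nat, of "c a"] by simp
  qed (use r_le r_ge in auto)
  have split: "sum f A = f b + sum f (A - {b})" for f :: "'a \<Rightarrow> real"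
    using assms(1) b by (rule sum.remove)
  have sum_q: "sum (q n) (A - {b}) = sum (r n) (A - {b})" for n
    by (rule sum.cong) (auto simp: q_def)
  show thesis
  proof
    fix n
    have "sum (r n) (A - {b}) \<le> sum c (A - {b})"
      by (rule sum_mono) (rule r_le)
    also have "\<dots> \<le> 1"
      using split[of c] c1 c[OF b] by simp
    finally show "q n \<in> simplex_weights A"
      using split[of "q n"] sum_q[of n] c
      by (auto simp: simplex_weights_def q_def r_def)
    show "q n a \<in> \<rat>" if "a \<in> A" for a
      by (auto simp: q_def r_def intro!: Rats_diff Rats_sum Rats_divide)
  next
    fix a assume "a \<in> A"
    have "(\<lambda>n. 1 - sum (r n) (A - {b})) \<longlonglongrightarrow> 1 - sum c (A - {b})"
      by (intro tendsto_intros r_lim)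
    moreover have "1 - sum c (A - {b}) = c b"
      using split[of c] c1 by simp
    ultimately show "(\<lambda>n. q n a) \<longlonglongrightarrow> c a"
      using r_lim[of a] by (cases "a = b") (simp_all add: q_def)
  qed
qed

text \<open>Both sums are continuous in the weights, so a late enough term of a rational
  approximation of \<open>c\<close> keeps the two strict inequalities.\<close>

lemma rational_weights_strict:
  fixes c g h :: "'a \<Rightarrow> real"
  assumes "finite A" and "c \<in> simplex_weights A"
    and "x < (\<Sum>a\<in>A. c a * g a)" and "y < (\<Sum>a\<in>A. c a * h a)"
  obtains q where "q \<in> simplex_weights A" and "\<And>a. a \<in> A \<Longrightarrow> q a \<in> \<rat>"
    and "x < (\<Sum>a\<in>A. q a * g a)" and "y < (\<Sum>a\<in>A. q a * h a)"
proof -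
  obtain q where q: "\<And>n. q n \<in> simplex_weights A" "\<And>n a. a \<in> A \<Longrightarrow> q n a \<in> \<rat>"
    and lim: "\<And>a. a \<in> A \<Longrightarrow> (\<lambda>n. q n a) \<longlonglongrightarrow> c a"
    using rational_simplex_weights_tendsto[OF assms(1,2)] by blast
  have sums: "(\<lambda>n. \<Sum>a\<in>A. q n a * f a) \<longlonglongrightarrow> (\<Sum>a\<in>A. c a * f a)" for f
    by (intro tendsto_intros lim)
  have "\<forall>\<^sub>F n in sequentially. x < (\<Sum>a\<in>A. q n a * g a) \<and> y < (\<Sum>a\<in>A. q n a * h a)"
    using assms(3,4) by (intro eventually_conj order_tendstoD(1)[OF sums])
  then obtain n where "x < (\<Sum>a\<in>A. q n a * g a)" "y < (\<Sum>a\<in>A. q n a * h a)"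
    using eventually_happens'[OF sequentially_bot] by blast
  then show thesis
    using that q by blast
qed

text \<open>A dominating payoff may tie in one coordinate, hence the weak bound \<open>y\<close>; in
  a tie, approximation alone could fall below it.\<close>

lemma rational_weights_weak:
  fixes c g h :: "'a \<Rightarrow> real"
  assumes "finite A" and "c \<in> simplex_weights A"
    and "x < (\<Sum>a\<in>A. c a * g a)" and "y \<le> (\<Sum>a\<in>A. c a * h a)"
  obtains q where "q \<in> simplex_weights A" and "\<And>a. a \<in> A \<Longrightarrow> q a \<in> \<rat>"
    and "x < (\<Sum>a\<in>A. q a * g a)" and "y \<le> (\<Sum>a\<in>A. q a * h a)"
proof -
  from assms(2) have c: "\<And>a. a \<in> A \<Longrightarrow> 0 \<le> c a" and c1: "sum c A = 1"
    by (auto simp: simplex_weights_def)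
  have vertex_sum: "(\<Sum>a\<in>A. of_bool (a = b) * f a) = f b" if "b \<in> A" for b and f :: "'a \<Rightarrow> real"
    using assms(1) that by (simp add: of_bool_def if_distrib[of "\<lambda>z. z * _"] cong: if_cong)
  show thesis
  proof (cases "\<exists>b\<in>A. y < h b")
    case True
    then obtain b where b: "b \<in> A" "y < h b" by blast
    define G where "G = (\<Sum>a\<in>A. c a * g a)"
    \<comment> \<open>The \<open>g\<close>-sum along the segment from \<open>c\<close> at
      \<open>t = 0\<close> to the vertex \<open>b\<close> at \<open>t = 1\<close> is continuous, so
      it stays above \<open>x\<close> for small \<open>t\<close>.\<close>
    have "((\<lambda>t. (1 - t) * G + t * g b) \<longlongrightarrow> (1 - 0) * G + 0 * g b) (at_right 0)"
      by (intro tendsto_intros)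
    then have "\<forall>\<^sub>F t in at_right 0. x < (1 - t) * G + t * g b"
      using assms(3) by (intro order_tendstoD(1)) (auto simp: G_def)
    \<comment> \<open>Positivity of \<open>t\<close> gives the strict gain in \<open>h\<close>;
      \<open>t < 1\<close> keeps the weights \<open>d\<close> nonnegative.\<close>
    moreover have "\<forall>\<^sub>F t in at_right (0::real). t \<in> {0<..<1}"
      by (rule eventually_at_right_real) simp
    ultimately have "\<forall>\<^sub>F t in at_right 0. x < (1 - t) * G + t * g b \<and> t \<in> {0<..<1}"
      by (rule eventually_conj)
    then obtain t where t: "x < (1 - t) * G + t * g b" "0 < t" "t < 1"
      using eventually_happens'[of "at_right (0::real)"] by (auto simp: trivial_limit_at_right_real)
    define d where "d a = (1 - t) * c a + t * of_bool (a = b)" for a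
    have d_sum: "(\<Sum>a\<in>A. d a * f a) = (1 - t) * (\<Sum>a\<in>A. c a * f a) + t * f b" for f
      using vertex_sum[OF b(1), of f]
      by (simp add: d_def distrib_right sum.distrib mult.assoc flip: sum_distrib_left)
    have d: "d \<in> simplex_weights A"
      using t c c1 d_sum[of "\<lambda>_. 1"] by (auto simp: simplex_weights_def d_def)
    have dx: "x < (\<Sum>a\<in>A. d a * g a)"
      using t by (simp add: d_sum G_def)
    have "(1 - t) * y \<le> (1 - t) * (\<Sum>a\<in>A. c a * h a)" "t * y < t * h b"
      using t assms(4) b by (simp_all add: mult_left_mono)
    moreover have "y = (1 - t) * y + t * y"
      by (simp add: algebra_simps)
    ultimately have dy: "y < (\<Sum>a\<in>A. d a * h a)"
      unfolding d_sum by linarith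
    obtain q where "q \<in> simplex_weights A" "\<And>a. a \<in> A \<Longrightarrow> q a \<in> \<rat>"
      "x < (\<Sum>a\<in>A. q a * g a)" "y < (\<Sum>a\<in>A. q a * h a)"
      using rational_weights_strict[OF assms(1) d dx dy] by blast
    then show thesis
      by (intro that[of q] less_imp_le[of y]) auto
  next
    case False
    then have le: "h a \<le> y" if "a \<in> A" for a
      using that by (meson not_le)
    \<comment> \<open>An average of values at most \<open>y\<close> can reach \<open>y\<close> only
      without slack: these terms are nonnegative with sum at most 0, so each vanishes.\<close>
    have "(\<Sum>a\<in>A. c a * (y - h a)) = y - (\<Sum>a\<in>A. c a * h a)"
      using c1 by (simp add: right_diff_distrib sum_subtractf flip: sum_distrib_right)
    then have "(\<Sum>a\<in>A. c a * (y - h a)) \<le> 0"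
      using assms(4) by simp
    moreover have nonneg: "0 \<le> c a * (y - h a)" if "a \<in> A" for a
      using c le that by simp
    ultimately have "(\<Sum>a\<in>A. c a * (y - h a)) = 0"
      by (meson order_antisym sum_nonneg)
    then have zero: "c a = 0 \<or> h a = y" if "a \<in> A" for a
      using sum_nonneg_eq_0_iff[OF assms(1), of "\<lambda>a. c a * (y - h a)"] nonneg that by auto
    have "\<exists>b\<in>A. c b \<noteq> 0 \<and> x < g b"
    proof (rule ccontr)
      assume "\<not> ?thesis"
      then have "c a * g a \<le> c a * x" if "a \<in> A" for a
        using c that by (cases "c a = 0") (auto intro: mult_left_mono simp: not_less)
      then have "(\<Sum>a\<in>A. c a * g a) \<le> (\<Sum>a\<in>A. c a * x)"
        by (rule sum_mono)
      also have "\<dots> = x"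
        using c1 by (simp flip: sum_distrib_right)
      finally show False
        using assms(3) by simp
    qed
    then obtain b where b: "b \<in> A" "c b \<noteq> 0" "x < g b" by blast
    \<comment> \<open>Since \<open>c b\<close> is nonzero, \<open>h b = y\<close>, so the point mass
      at \<open>b\<close> meets the weak inequality with equality.\<close>
    show thesis
    proof
      show "(\<lambda>a. of_bool (a = b)) \<in> simplex_weights A"
        using vertex_sum[OF b(1), of "\<lambda>_. 1"] by (simp add: simplex_weights_def)
    qed (use b zero vertex_sum in auto)
  qed
qed

lemma rational_distribution_weak:
  fixes g h :: "'a \<Rightarrow> real"
  assumes "finite A" and "p \<in> distributions A"
    and "x < (\<Sum>a\<in>A. pmf p a * g a)" and "y \<le> (\<Sum>a\<in>A. pmf p a * h a)"
  obtains q where "q \<in> rational_distributions A"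
    and "x < (\<Sum>a\<in>A. pmf q a * g a)" and "y \<le> (\<Sum>a\<in>A. pmf q a * h a)"
proof -
  obtain c where c: "c \<in> simplex_weights A" "\<And>a. a \<in> A \<Longrightarrow> c a \<in> \<rat>"
    "x < (\<Sum>a\<in>A. c a * g a)" "y \<le> (\<Sum>a\<in>A. c a * h a)"
    using rational_weights_weak[OF assms(1) pmf_simplex_weights[OF assms(1,2)] assms(3,4)] by blast
  obtain q where q: "q \<in> distributions A" "\<And>a. a \<in> A \<Longrightarrow> pmf q a = c a"
    using simplex_weights_pmf[OF assms(1) c(1)] by blast
  show thesis
    by (rule that[of q]) (use q c in \<open>auto simp: rational_distributions_def\<close>)
qed

section \<open>Pareto frontiers of a set and of an approximating subset\<close>

text \<open>Dominance in the plane is a strict inequality in one coordinate and a weak one in the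
  other, so \<open>approx\<close> turns a dominating point of \<open>S\<close> into one of
  \<open>R\<close>.\<close>

lemma pareto_frontier_subset:
  fixes R S :: "(real ^ 2) set"
  assumes "R \<subseteq> S"
    and approx: "\<And>w i j x y. w \<in> S \<Longrightarrow> x < w $ i \<Longrightarrow> y \<le> w $ j \<Longrightarrow> \<exists>r\<in>R. x < r $ i \<and> y \<le> r $ j"
  shows "pareto_frontier R \<subseteq> pareto_frontier S"
proof
  fix v assume v: "v \<in> pareto_frontier R"
  have False if w: "w \<in> S" and dom: "pareto_dominates w v" for w
  proof -
    obtain i where i: "v $ i < w $ i"
      using dom unfolding pareto_dominates_def vec_eq_iff by (metis order_neq_le_trans)
    \<comment> \<open>The index type has two elements; \<open>j\<close> is the one other than
      \<open>i\<close>.\<close>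
    obtain j :: 2 where j: "\<And>k. k = i \<or> k = j"
      using exhaust_2 by metis
    obtain r where r: "r \<in> R" "v $ i < r $ i" "v $ j \<le> r $ j"
      using approx[OF w i, of "v $ j" j] dom by (auto simp: pareto_dominates_def)
    have "v $ k \<le> r $ k" for k
      using r(2,3) j[of k] by auto
    then have "pareto_dominates r v"
      using r(2) by (auto simp: pareto_dominates_def)
    then show False
      using v r(1) by (auto simp: pareto_frontier_def)
  qed
  then show "v \<in> pareto_frontier S"
    using v assms(1) by (auto simp: pareto_frontier_def)
qed

section \<open>The noncooperative region\<close>

lemma mixed_payoff_nth:
  "mixed_payoff A B u p q $ i = (\<Sum>a\<in>A. pmf p a * (\<Sum>b\<in>B. pmf q b * u (a, b) $ i))"
  by (simp add: mixed_payoff_def sum_distrib_left mult.assoc)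

text \<open>With \<open>mixed_payoff_nth\<close>, this presents a coordinate as an average over
  either player's strategy while the other is fixed, the form
  \<open>rational_distribution_weak\<close> handles.\<close>

lemma mixed_payoff_nth_swap:
  "mixed_payoff A B u p q $ i = (\<Sum>b\<in>B. pmf q b * (\<Sum>a\<in>A. pmf p a * u (a, b) $ i))"
  unfolding mixed_payoff_nth sum_distrib_left
  by (subst sum.swap) (simp add: mult.left_commute)

lemma pareto_frontier_S_nc_rat:
  assumes "finite A" and "finite B"
  shows "pareto_frontier (S_nc_rat A B u) \<subseteq> pareto_frontier (S_nc A B u)"
proof (rule pareto_frontier_subset)
  show "S_nc_rat A B u \<subseteq> S_nc A B u"
    unfolding S_nc_rat_def S_nc_def rational_distributions_def by blast
next
  fix w i j x y
  assume "w \<in> S_nc A B u" and lower: "x < w $ i" "y \<le> w $ j"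
  then obtain p q where pq: "p \<in> distributions A" "q \<in> distributions B" "w = mixed_payoff A B u p q"
    by (auto simp: S_nc_def)
  \<comment> \<open>\<open>q\<close> stays fixed while \<open>p\<close> is made rational. The bounds
    \<open>x\<close> and \<open>y\<close> survive unchanged, so \<open>q\<close> can then be
    replaced against \<open>p'\<close>.\<close>
  obtain p' where p': "p' \<in> rational_distributions A"
    "x < mixed_payoff A B u p' q $ i" "y \<le> mixed_payoff A B u p' q $ j"
    using lower unfolding pq(3) mixed_payoff_nth
    by (rule rational_distribution_weak[OF assms(1) pq(1)])
  obtain q' where q': "q' \<in> rational_distributions B"
    "x < mixed_payoff A B u p' q' $ i" "y \<le> mixed_payoff A B u p' q' $ j"
    using p'(2,3) unfolding mixed_payoff_nth_swap
    by (rule rational_distribution_weak[OF assms(2) pq(2)])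
  show "\<exists>r\<in>S_nc_rat A B u. x < r $ i \<and> y \<le> r $ j"
    using p'(1) q' by (auto simp: S_nc_rat_def)
qed

section \<open>The cooperative region\<close>

lemma S_co_rat_eq_image:
  "S_co_rat A B u =
    (\<lambda>c. \<Sum>a\<in>A \<times> B. c a *\<^sub>R u a) ` {c \<in> simplex_weights (A \<times> B). \<forall>a\<in>A \<times> B. c a \<in> \<rat>}"
  unfolding S_co_rat_def simplex_weights_def image_def mem_Collect_eq Bex_def
  by (intro Collect_cong ex_cong1) (simp only: ball_conj_distrib conj_ac)

text \<open>The payoff is linear in the correlated weights, so one use of
  \<open>rational_weights_weak\<close> suffices; it yields coefficients rather than a pmf, as
  \<open>S_co_rat\<close> asks.\<close>

lemma pareto_frontier_S_co_rat:
  assumes "finite A" and "finite B"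
  shows "pareto_frontier (S_co_rat A B u) \<subseteq> pareto_frontier (S_co A B u)"
proof (rule pareto_frontier_subset)
  have fin: "finite (A \<times> B)"
    using assms by simp
  show "S_co_rat A B u \<subseteq> S_co A B u"
  proof
    fix v assume "v \<in> S_co_rat A B u"
    then obtain c where c: "c \<in> simplex_weights (A \<times> B)" "v = (\<Sum>a\<in>A \<times> B. c a *\<^sub>R u a)"
      unfolding S_co_rat_eq_image by auto
    obtain p where p: "p \<in> distributions (A \<times> B)" "\<And>a. a \<in> A \<times> B \<Longrightarrow> pmf p a = c a"
      using simplex_weights_pmf[OF fin c(1)] by blast
    have "v = correlated_payoff A B u p"
      unfolding c(2) correlated_payoff_def by (rule sum.cong) (simp_all only: p(2))
    then show "v \<in> S_co A B u"
      using p(1) by (auto simp: S_co_def)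
  qed
  fix w i j x y
  assume "w \<in> S_co A B u" and lower: "x < w $ i" "y \<le> w $ j"
  then obtain p where p: "p \<in> distributions (A \<times> B)" and w: "w = (\<Sum>a\<in>A \<times> B. pmf p a *\<^sub>R u a)"
    by (auto simp: S_co_def correlated_payoff_def)
  have "x < (\<Sum>a\<in>A \<times> B. pmf p a * u a $ i)" "y \<le> (\<Sum>a\<in>A \<times> B. pmf p a * u a $ j)"
    using lower by (simp_all add: w)
  from rational_weights_weak[OF fin pmf_simplex_weights[OF fin p] this]
  obtain c where c: "c \<in> simplex_weights (A \<times> B)" "\<And>a. a \<in> A \<times> B \<Longrightarrow> c a \<in> \<rat>"
    "x < (\<Sum>a\<in>A \<times> B. c a * u a $ i)" "y \<le> (\<Sum>a\<in>A \<times> B. c a * u a $ j)"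
    by blast
  have "(\<Sum>a\<in>A \<times> B. c a *\<^sub>R u a) \<in> S_co_rat A B u"
    unfolding S_co_rat_eq_image by (rule imageI) (use c(1,2) in simp)
  then show "\<exists>r\<in>S_co_rat A B u. x < r $ i \<and> y \<le> r $ j"
    by (rule bexI[rotated]) (use c(3,4) in simp)
qed

theorem theorem5p3:
  fixes A\<^sub>1 :: "'a set" and A\<^sub>2 :: "'b set"
    and u\<^sub>1 u\<^sub>2 :: "'a \<times> 'b \<Rightarrow> real"
  assumes "finite A\<^sub>1" and "A\<^sub>1 \<noteq> {}" and "finite A\<^sub>2" and "A\<^sub>2 \<noteq> {}"
  shows "pareto_frontier (S_nc_rat A\<^sub>1 A\<^sub>2 (payoff u\<^sub>1 u\<^sub>2)) \<subseteq> pareto_frontier (S_nc A\<^sub>1 A\<^sub>2 (payoff u\<^sub>1 u\<^sub>2)) \<and>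
         pareto_frontier (S_co_rat A\<^sub>1 A\<^sub>2 (payoff u\<^sub>1 u\<^sub>2)) \<subseteq> pareto_frontier (S_co A\<^sub>1 A\<^sub>2 (payoff u\<^sub>1 u\<^sub>2))"
  by (intro conjI pareto_frontier_S_nc_rat pareto_frontier_S_co_rat assms)

end
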